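(* Let $X$ be any real random variable with characteristic function $f(t)=\mathsf{E}e^{itX}$, $t\in\mathbb{R}$, such that $\mathsf{E}|X|^n<\infty$ for some $n\in\mathbb{N}$, $n\geq 1$. Put $\alpha_k=\mathsf{E}X^k$ for $0\leq k\leq n$ (so $\alpha_0=1$) and $\beta_n=\mathsf{E}|X|^n$. Then for all $t\in\mathbb{R}$ and all $\lambda\geq 0$ $$\bigg|f(t)-\sum_{k=0}^{n-1}\frac{\alpha_k(it)^k}{k!}-\lambda\frac{\alpha_n(it)^n}{n!}\bigg|\leq q_n(\lambda)\frac{\beta_n|t|^n}{n!},$$ and, for every integer $\ell$ with $1\leq \ell\leq n-1$, $$\bigg|\frac{d^\ell f(t)}{dt^\ell}-\sum_{k=0}^{n-\ell-1}i^{\ell+k}\alpha_{\ell+k}\frac{t^k}{k!}-\lambda\frac{i^n\alpha_n t^{n-\ell}}{(n-\ell)!}\bigg|\leq q_{n-\ell}(\lambda)\frac{\beta_n|t|^{n-\ell}}{(n-\ell)!}.$$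
   Context: For $m\in\{1,2,\ldots\}$ and $\lambda\geq0$ define $$q_m(\lambda)=\sup_{x>0}\frac{m!}{x^m}\bigg|e^{ix}-\sum_{k=0}^{m-1}\frac{(ix)^k}{k!}-\lambda\frac{(ix)^m}{m!}\bigg|.$$ $\mathsf{E}$ denotes mathematical expectation. *)

theory Defs
  imports "HOL-Probability.Probability"
begin

definition q :: "nat \<Rightarrow> real \<Rightarrow> real" where
  "q m lam = (SUP x\<in>{0<..}. fact m / x ^ m *
     cmod (exp (\<i> * of_real x) - (\<Sum>k<m. (\<i> * of_real x) ^ k / fact k)
           - of_real lam * (\<i> * of_real x) ^ m / fact m))"

text \<open>The real supremum in \<^const>\<open>q\<close> is taken over a bounded set, so it is the actual supremum.\<close>

lemma bdd_above_q:
  assumes "m \<ge> 1" "lam \<ge> 0"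
  shows "bdd_above ((\<lambda>x. fact m / x ^ m *
     cmod (exp (\<i> * of_real x) - (\<Sum>k<m. (\<i> * of_real x) ^ k / fact k)
           - of_real lam * (\<i> * of_real x) ^ m / fact m)) ` {0<..})"
proof (rule bdd_aboveI2)
  fix x :: real assume "x \<in> {0<..}"
  then have x: "x > 0" by simp
  define A where "A = exp (\<i> * of_real x) - (\<Sum>k<m. (\<i> * of_real x) ^ k / fact k)"
  obtain p where p: "m = Suc p" using assms by (cases m) auto
  have "cmod A \<le> \<bar>x\<bar> ^ m / fact m"
    using iexp_approx1[of x p] by (simp add: A_def p lessThan_Suc_atMost)
  moreover have "cmod (of_real lam * (\<i> * of_real x) ^ m / fact m) = lam * (x ^ m / fact m)"
    using assms x by (simp add: norm_mult norm_divide norm_power)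
  moreover have "cmod (A - of_real lam * (\<i> * of_real x) ^ m / fact m)
      \<le> cmod A + cmod (of_real lam * (\<i> * of_real x) ^ m / fact m)"
    by (rule norm_triangle_ineq4)
  ultimately have "cmod (A - of_real lam * (\<i> * of_real x) ^ m / fact m)
      \<le> (1 + lam) * (x ^ m / fact m)"
    using x unfolding distrib_right mult_1_left by simp
  then have "fact m / x ^ m * cmod (A - of_real lam * (\<i> * of_real x) ^ m / fact m)
      \<le> fact m / x ^ m * ((1 + lam) * (x ^ m / fact m))"
    using x by (intro mult_left_mono) auto
  also have "\<dots> = 1 + lam" using x by simp
  finally show "fact m / x ^ m *
     cmod (exp (\<i> * of_real x) - (\<Sum>k<m. (\<i> * of_real x) ^ k / fact k)
           - of_real lam * (\<i> * of_real x) ^ m / fact m) \<le> 1 + lam"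
    by (simp add: A_def)
qed

text \<open>Iterated derivative of a complex-valued function of a real variable.
  It is only meaningful where the lower-order derivatives are differentiable.\<close>

definition vderiv_iter :: "nat \<Rightarrow> (real \<Rightarrow> complex) \<Rightarrow> real \<Rightarrow> complex" where
  "vderiv_iter l f = ((\<lambda>g t. vector_derivative g (at t)) ^^ l) f"

lemma char_distr_eq_expectation:
  assumes "X \<in> borel_measurable M"
  shows "char (distr M borel X) t = (LINT w|M. exp (\<i> * of_real t * of_real (X w)))"
  unfolding char_def using assms by (subst integral_distr) (auto simp: mult.assoc)

end

theory Submission
  imports Defs
begin

text \<open>
  Substituting \<open>x = tX\<close> bounds the remainder of \<open>e\<^sup>i\<^sup>t\<^sup>X\<close> pointwise by
  \<open>q\<^sub>m(\<lambda>) \<bar>tX\<bar>\<^sup>m / m!\<close>; negative arguments reduce to positive ones by complex conjugation.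
  Dominated convergence gives that the \<open>l\<close>-th derivative of the characteristic function is
  the expectation of \<open>(iX)\<^sup>l e\<^sup>i\<^sup>t\<^sup>X\<close>. Multiplying the pointwise bound with \<open>m = n - l\<close> by
  \<open>\<bar>X\<bar>\<^sup>l\<close> and taking expectations yields both inequalities at once.
\<close>

definition exp_rem :: "nat \<Rightarrow> real \<Rightarrow> real \<Rightarrow> complex" where
  "exp_rem m lam x = exp (\<i> * of_real x) - (\<Sum>k<m. (\<i> * of_real x) ^ k / fact k)
     - of_real lam * (\<i> * of_real x) ^ m / fact m"

lemma exp_rem_minus: "exp_rem m lam (- x) = cnj (exp_rem m lam x)"
  by (simp add: exp_rem_def exp_cnj)

lemma norm_exp_rem_le:
  assumes "m \<ge> 1" "lam \<ge> 0"
  shows "cmod (exp_rem m lam x) \<le> q m lam * (\<bar>x\<bar> ^ m / fact m)"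
proof -
  have pos: "cmod (exp_rem m lam y) \<le> q m lam * (\<bar>y\<bar> ^ m / fact m)" if "y > 0" for y
  proof -
    have "fact m / y ^ m * cmod (exp_rem m lam y) \<le> q m lam"
      unfolding q_def exp_rem_def
      using that by (intro cSUP_upper bdd_above_q assms) auto
    then show ?thesis
      using that by (simp add: field_simps)
  qed
  consider "x > 0" | "x = 0" | "- x > 0" by linarith
  then show ?thesis
  proof cases
    case 2
    \<comment> \<open>The supremum in \<open>q\<close> ranges over positive points only, so zero is
      checked directly: since \<open>0 ^ 0 = 1\<close>, the sum reduces to its first term and
      cancels \<open>exp 0\<close>, while \<open>m \<ge> 1\<close> removes the \<open>lam\<close>
      term.\<close>
    have "(\<Sum>k<m. (0::complex) ^ k / fact k) = (\<Sum>k\<in>{0}. 0 ^ k / fact k)"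
      using assms by (intro sum.mono_neutral_right) auto
    then show ?thesis using 2 assms by (simp add: exp_rem_def power_0_left)
  next
    case 3
    show ?thesis using pos[OF 3] by (simp add: exp_rem_minus)
  qed (rule pos)
qed

context prob_space
begin

lemma integrable_abs_power_le:
  fixes X :: "'a \<Rightarrow> real"
  assumes "X \<in> borel_measurable M" "integrable M (\<lambda>w. \<bar>X w\<bar> ^ n)" "k \<le> n"
  shows "integrable M (\<lambda>w. \<bar>X w\<bar> ^ k)"
proof (rule Bochner_Integration.integrable_bound)
  \<comment> \<open>The summand 1 dominates where \<open>\<bar>X w\<bar> \<le> 1\<close>; it is
    integrable because \<open>M\<close> has finite total mass.\<close>
  show "integrable M (\<lambda>w. 1 + \<bar>X w\<bar> ^ n)" using assms by simp
  have "\<bar>x\<bar> ^ k \<le> 1 + \<bar>x\<bar> ^ n" for x :: real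
  proof (cases "\<bar>x\<bar> \<le> 1")
    case True
    then have "\<bar>x\<bar> ^ k \<le> 1" by (simp add: power_le_one)
    then show ?thesis by (smt (verit) zero_le_power abs_ge_zero)
  next
    case False
    then have "\<bar>x\<bar> ^ k \<le> \<bar>x\<bar> ^ n" using assms by (intro power_increasing) auto
    then show ?thesis by simp
  qed
  then show "AE w in M. norm (\<bar>X w\<bar> ^ k) \<le> norm (1 + \<bar>X w\<bar> ^ n)"
    by (auto simp: power_abs)
qed (use assms in measurable)

lemma integrable_power_iexp:
  fixes X :: "'a \<Rightarrow> real"
  assumes "X \<in> borel_measurable M" "integrable M (\<lambda>w. \<bar>X w\<bar> ^ n)" "k \<le> n"
  shows "integrable M (\<lambda>w. (\<i> * of_real (X w)) ^ k * iexp (t * X w))"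
  by (rule Bochner_Integration.integrable_bound[OF integrable_abs_power_le[OF assms]])
     (use assms(1) in \<open>auto simp: norm_mult norm_power\<close>)

text \<open>Differentiation under the expectation. Dominated convergence is applied to the quotient
  \<open>R\<close> of the first-order remainder, with dominating function
  \<open>2 * \<bar>X w\<bar> ^ Suc k\<close>, which is integrable because
  \<open>k < n\<close>.\<close>

lemma expectation_power_iexp_has_vector_derivative:
  fixes X :: "'a \<Rightarrow> real"
  assumes [measurable]: "X \<in> borel_measurable M"
    and int: "integrable M (\<lambda>w. \<bar>X w\<bar> ^ n)" and "k < n"
  shows "((\<lambda>t. CLINT w|M. (\<i> * of_real (X w)) ^ k * iexp (t * X w)) has_vector_derivative
          (CLINT w|M. (\<i> * of_real (X w)) ^ Suc k * iexp (t * X w))) (at t)"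
    (is "(?F has_vector_derivative ?D) _")
proof -
  define G where "G w s = (\<i> * of_real (X w)) ^ k * iexp (s * X w)" for w s
  have intG: "integrable M (\<lambda>w. G w s)" for s
    unfolding G_def using assms by (intro integrable_power_iexp[OF _ int]) auto
  define G' where "G' w = (\<i> * of_real (X w)) ^ Suc k * iexp (t * X w)" for w
  have deriv: "(G w has_vector_derivative G' w) (at t)" for w
  proof -
    \<comment> \<open>The complex derivative in \<open>z\<close> is computed first and then
      restricted to the real line.\<close>
    have "((\<lambda>z. (\<i> * of_real (X w)) ^ k * exp (\<i> * (z * of_real (X w)))) has_field_derivative
        (\<i> * of_real (X w)) ^ Suc k * exp (\<i> * (of_real t * of_real (X w)))) (at (of_real t))"
      by (auto intro!: derivative_eq_intros)
    from has_vector_derivative_real_field[OF this] show ?thesis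
      by (simp add: G_def [abs_def] G'_def)
  qed
  \<comment> \<open>By definition, \<open>G w\<close> has derivative \<open>G' w\<close> at
    \<open>t\<close> exactly when this quotient tends to 0, and the same reading applies to the
    expectations at the end.\<close>
  define R where "R w s = (G w s - G w t - (s - t) *\<^sub>R G' w) /\<^sub>R \<bar>s - t\<bar>" for w s
  have intG': "integrable M G'"
    unfolding G'_def using assms by (intro integrable_power_iexp[OF _ int]) auto
  have lim: "((\<lambda>s. R w s) \<longlongrightarrow> 0) (at t)" for w
    using deriv[of w] unfolding R_def has_vector_derivative_def has_derivative_at_within by simp
  have bound: "cmod (R w s) \<le> 2 * \<bar>X w\<bar> ^ Suc k" if "s \<noteq> t" for w s
  proof -
    define u where "u = (s - t) * X w"
    \<comment> \<open>Factoring out the unimodular \<open>iexp (t * X w)\<close> leaves the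
      first-order Taylor remainder of \<open>iexp\<close> at \<open>u\<close>.\<close>
    have "G w s - G w t - (s - t) *\<^sub>R G' w
        = (\<i> * of_real (X w)) ^ k * iexp (t * X w) * (iexp u - (\<Sum>j\<le>1. (\<i> * u) ^ j / fact j))"
    proof -
      have "iexp (s * X w) = iexp (t * X w) * iexp u"
        by (simp add: u_def flip: exp_add) (simp add: algebra_simps)
      then show ?thesis
        unfolding G_def G'_def by (simp add: u_def scaleR_conv_of_real algebra_simps)
    qed
    then have "cmod (R w s) * \<bar>s - t\<bar>
        = \<bar>X w\<bar> ^ k * cmod (iexp u - (\<Sum>j\<le>1. (\<i> * u) ^ j / fact j))"
      using that unfolding R_def by (simp add: norm_mult norm_power)
    \<comment> \<open>The bound linear in \<open>u\<close> is chosen over the quadratic one, which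
      would require a moment of order \<open>k + 2\<close>.\<close>
    also have "\<dots> \<le> \<bar>X w\<bar> ^ k * (2 * \<bar>u\<bar>)"
      using iexp_approx2[of u 1] by (intro mult_left_mono) auto
    also have "\<dots> = 2 * \<bar>X w\<bar> ^ Suc k * \<bar>s - t\<bar>"
      by (simp add: u_def abs_mult)
    finally show ?thesis using that by simp
  qed
  have "((\<lambda>s. CLINT w|M. R w s) \<longlongrightarrow> 0) (at t)"
    \<comment> \<open>Dominated convergence is used in its sequential form; the sequences avoid
      \<open>t\<close>, as \<open>bound\<close> demands.\<close>
    unfolding tendsto_at_iff_sequentially comp_def
  proof (intro allI impI)
    fix S :: "nat \<Rightarrow> real"
    assume S: "\<forall>i. S i \<in> UNIV - {t}" "S \<longlonglongrightarrow> t"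
    have "(\<lambda>i. CLINT w|M. R w (S i)) \<longlonglongrightarrow> (CLINT w|M. 0)"
    proof (rule integral_dominated_convergence)
      show "integrable M (\<lambda>w. 2 * \<bar>X w\<bar> ^ Suc k)"
        using integrable_abs_power_le[OF assms(1) int, of "Suc k"] \<open>k < n\<close> by simp
      show "AE w in M. (\<lambda>i. R w (S i)) \<longlonglongrightarrow> 0"
        using lim S unfolding tendsto_at_iff_sequentially comp_def by auto
      show "AE w in M. norm (R w (S i)) \<le> 2 * \<bar>X w\<bar> ^ Suc k" for i
        using bound S by auto
    qed (auto simp: R_def G_def G'_def)
    then show "(\<lambda>i. CLINT w|M. R w (S i)) \<longlonglongrightarrow> 0" by simp
  qed
  moreover have "(CLINT w|M. R w s)
      = ((CLINT w|M. G w s) - (CLINT w|M. G w t) - (s - t) *\<^sub>R (CLINT w|M. G' w)) /\<^sub>R \<bar>s - t\<bar>" for s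
    unfolding R_def using intG intG' by simp
  ultimately show ?thesis
    unfolding has_vector_derivative_def has_derivative_at_within G_def G'_def
    by (simp add: bounded_linear_scaleR_left)
qed

text \<open>The equation is between functions on the whole line because the induction step
  differentiates the previous formula as a function of \<open>t\<close>.\<close>

lemma vderiv_iter_char:
  fixes X :: "'a \<Rightarrow> real"
  assumes "X \<in> borel_measurable M" "integrable M (\<lambda>w. \<bar>X w\<bar> ^ n)" "k \<le> n"
  shows "vderiv_iter k (char (distr M borel X))
    = (\<lambda>t. CLINT w|M. (\<i> * of_real (X w)) ^ k * iexp (t * X w))"
  using \<open>k \<le> n\<close>
proof (induction k)
  case 0
  then show ?case
    using assms(1) by (simp add: vderiv_iter_def char_distr_eq_expectation fun_eq_iff mult.assoc)
next
  case (Suc k)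
  then have "vderiv_iter (Suc k) (char (distr M borel X))
      = (\<lambda>t. vector_derivative (\<lambda>t. CLINT w|M. (\<i> * of_real (X w)) ^ k * iexp (t * X w)) (at t))"
    by (simp add: vderiv_iter_def)
  also have "\<dots> = (\<lambda>t. CLINT w|M. (\<i> * of_real (X w)) ^ Suc k * iexp (t * X w))"
    using Suc.prems assms
    by (intro ext vector_derivative_at expectation_power_iexp_has_vector_derivative) auto
  finally show ?case .
qed

lemma norm_vderiv_iter_char_remainder_le:
  fixes X :: "'a \<Rightarrow> real"
  assumes X: "X \<in> borel_measurable M"
    and int: "integrable M (\<lambda>w. \<bar>X w\<bar> ^ n)" and "l < n" "lam \<ge> 0"
  shows "cmod (vderiv_iter l (char (distr M borel X)) t
      - (\<Sum>k<n - l. \<i> ^ (l + k) * of_real (expectation (\<lambda>w. X w ^ (l + k))) * of_real t ^ k / fact k)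
      - of_real lam * (\<i> ^ n * of_real (expectation (\<lambda>w. X w ^ n)) * of_real t ^ (n - l) / fact (n - l)))
    \<le> q (n - l) lam * (expectation (\<lambda>w. \<bar>X w\<bar> ^ n) * \<bar>t\<bar> ^ (n - l) / fact (n - l))"
    (is "cmod ?L \<le> ?B")
proof -
  define m where "m = n - l"
  have m: "m \<ge> 1" "n = l + m" using \<open>l < n\<close> by (auto simp: m_def)
  have intX: "integrable M (\<lambda>w. complex_of_real (X w ^ k))" if "k \<le> n" for k
  proof -
    have "integrable M (\<lambda>w. X w ^ k)"
      using integrable_abs_power_le[OF X int that] X
      by (subst integrable_norm_iff [symmetric]) (auto simp: power_abs)
    then show ?thesis by (rule integrable_of_real)
  qed
  \<comment> \<open>The factor \<open>(\<i> * of_real (X w)) ^ l\<close> shifts each power of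
    \<open>X w\<close> by \<open>l\<close>. Constants are collected in front so that taking
    expectations leaves only moments of \<open>X\<close>.\<close>
  have eq: "(\<i> * of_real (X w)) ^ l * exp_rem m lam (t * X w)
      = (\<i> * of_real (X w)) ^ l * iexp (t * X w)
        - (\<Sum>k<m. (\<i> ^ (l + k) * of_real t ^ k / fact k) * of_real (X w ^ (l + k)))
        - (of_real lam * \<i> ^ n * of_real t ^ m / fact m) * of_real (X w ^ n)" for w
    unfolding exp_rem_def m(2)
    by (simp add: right_diff_distrib sum_distrib_left power_add power_mult_distrib mult_ac)
  \<comment> \<open>This form carries integrability and the value of the integral together; both are
    needed below.\<close>
  have "has_bochner_integral M (\<lambda>w. (\<i> * of_real (X w)) ^ l * exp_rem m lam (t * X w))
      ((CLINT w|M. (\<i> * of_real (X w)) ^ l * iexp (t * X w))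
        - (\<Sum>k<m. (\<i> ^ (l + k) * of_real t ^ k / fact k) * (CLINT w|M. of_real (X w ^ (l + k))))
        - (of_real lam * \<i> ^ n * of_real t ^ m / fact m) * (CLINT w|M. of_real (X w ^ n)))"
    unfolding eq using m(2)
    by (intro has_bochner_integral_diff has_bochner_integral_sum has_bochner_integral_mult_right
          has_bochner_integral_integrable intX integrable_power_iexp[OF X int]) auto
  then have has: "has_bochner_integral M (\<lambda>w. (\<i> * of_real (X w)) ^ l * exp_rem m lam (t * X w)) ?L"
    using \<open>l < n\<close> by (simp add: vderiv_iter_char[OF X int] mult_ac m_def flip: of_real_power)
  then have "?L = (CLINT w|M. (\<i> * of_real (X w)) ^ l * exp_rem m lam (t * X w))"
    by (rule has_bochner_integral_integral_eq [symmetric])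
  also have "cmod \<dots> \<le> (LINT w|M. q m lam * (\<bar>t\<bar> ^ m / fact m) * \<bar>X w\<bar> ^ n)"
  proof (rule order_trans[OF integral_norm_bound integral_mono])
    show "integrable M (\<lambda>w. cmod ((\<i> * of_real (X w)) ^ l * exp_rem m lam (t * X w)))"
      using has by (intro integrable_norm integrable.intros)
    fix w
    have "cmod ((\<i> * of_real (X w)) ^ l * exp_rem m lam (t * X w))
        \<le> \<bar>X w\<bar> ^ l * (q m lam * (\<bar>t * X w\<bar> ^ m / fact m))"
      unfolding norm_mult norm_power norm_ii norm_of_real mult_1_left
      using norm_exp_rem_le[OF m(1) \<open>lam \<ge> 0\<close>] by (intro mult_left_mono) auto
    also have "\<dots> = q m lam * (\<bar>t\<bar> ^ m / fact m) * \<bar>X w\<bar> ^ n"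
      by (simp add: m(2) abs_mult power_mult_distrib power_add)
    finally show "cmod ((\<i> * of_real (X w)) ^ l * exp_rem m lam (t * X w)) \<le> \<dots>" .
  qed (use int in simp)
  also have "\<dots> = ?B" by (simp add: m_def)
  finally show ?thesis .
qed

end

theorem theorem1:
  fixes M :: "'a measure" and X :: "'a \<Rightarrow> real" and n :: nat
    and f :: "real \<Rightarrow> complex" and \<alpha> :: "nat \<Rightarrow> real" and \<beta> :: real
  assumes "prob_space M"
    and "X \<in> borel_measurable M"
    and "n \<ge> 1"
    and "integrable M (\<lambda>w. \<bar>X w\<bar> ^ n)"
    and "f = char (distr M borel X)"
    and "\<And>k. k \<le> n \<Longrightarrow> \<alpha> k = (LINT w|M. X w ^ k)"
    and "\<beta> = (LINT w|M. \<bar>X w\<bar> ^ n)"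
  shows "(\<forall>t::real. \<forall>lam\<ge>0.
            cmod (f t - (\<Sum>k<n. of_real (\<alpha> k) * (\<i> * of_real t) ^ k / fact k)
                  - of_real lam * (of_real (\<alpha> n) * (\<i> * of_real t) ^ n / fact n))
              \<le> q n lam * (\<beta> * \<bar>t\<bar> ^ n / fact n))
       \<and> (\<forall>l. 1 \<le> l \<and> l \<le> n - 1 \<longrightarrow>
            (\<forall>j<l. \<forall>s. vderiv_iter j f differentiable (at s))
          \<and> (\<forall>t::real. \<forall>lam\<ge>0.
              cmod (vderiv_iter l f t
                    - (\<Sum>k<n - l. \<i> ^ (l + k) * of_real (\<alpha> (l + k)) * of_real t ^ k / fact k)
                    - of_real lam * (\<i> ^ n * of_real (\<alpha> n) * of_real t ^ (n - l) / fact (n - l)))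
                \<le> q (n - l) lam * (\<beta> * \<bar>t\<bar> ^ (n - l) / fact (n - l))))"
proof -
  interpret prob_space M by fact
  note X = assms(2,4) and f = assms(5)
  have \<alpha>: "expectation (\<lambda>w. X w ^ k) = \<alpha> k" if "k \<le> n" for k
    using assms(6)[OF that] by simp
  have bound: "cmod (vderiv_iter l f t
          - (\<Sum>k<n - l. \<i> ^ (l + k) * of_real (\<alpha> (l + k)) * of_real t ^ k / fact k)
          - of_real lam * (\<i> ^ n * of_real (\<alpha> n) * of_real t ^ (n - l) / fact (n - l)))
        \<le> q (n - l) lam * (\<beta> * \<bar>t\<bar> ^ (n - l) / fact (n - l))"
    if "l < n" "lam \<ge> 0" for l t lam
    \<comment> \<open>The moments are known to equal \<open>\<alpha>\<close> only up to order
      \<open>n\<close>, so the congruence rule must supply the index bound \<open>k < n - l\<close>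
      under the sum.\<close>
    using norm_vderiv_iter_char_remainder_le[OF X that, of t]
    by (simp add: \<alpha> f assms(7) cong: sum.cong_simp)
  \<comment> \<open>\<open>vector_derivative\<close> is a total operator, so the estimate alone does
    not show that the derivatives exist.\<close>
  have diff: "vderiv_iter j f differentiable (at s)" if "j < n" for j s
    using expectation_power_iexp_has_vector_derivative[OF X that, of s] that
    by (auto simp: f vderiv_iter_char[OF X] intro: differentiableI_vector)
  show ?thesis
  proof (intro conjI allI impI)
    fix t lam :: real assume "lam \<ge> 0"
    then show "cmod (f t - (\<Sum>k<n. of_real (\<alpha> k) * (\<i> * of_real t) ^ k / fact k)
          - of_real lam * (of_real (\<alpha> n) * (\<i> * of_real t) ^ n / fact n))
        \<le> q n lam * (\<beta> * \<bar>t\<bar> ^ n / fact n)"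
      using bound[of 0 lam t] assms(3)
      by (simp add: vderiv_iter_def power_mult_distrib mult_ac)
  qed (use diff bound in auto)
qed

end
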